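(* Every decomposable phylogenetic network on $X$ with $|X|\ge 5$ is leaf-reconstructible.
   Context: $X$ is a finite set. A phylogenetic tree on $X$ is a tree with no degree-2 vertices whose leaves (degree-1 vertices) are bijectively labelled by the elements of $X$. A blob of a graph is a maximal 2-connected subgraph with at least two edges. A phylogenetic network on $X$ is a connected graph $N$ such that contracting each blob into a single vertex yields a phylogenetic tree on $X$ (networks need not be binary). A cut-edge is trivial if at least one of its endpoints is a leaf; a phylogenetic network is decomposable if it has at least one nontrivial cut-edge. A pseudo-network on $X$ is a multigraph with no degree-2 vertices whose leaves are bijectively labelled by $X$. Two pseudo-networks are equivalent ($\sim$) if there is a graph isomorphism between them that is the identity on $X$. For a phylogenetic network $N$ and a vertex $v$, $N_v$ is the pseudo-network obtained by deleting $v$ with its incident edges and suppressing resulting degree-2 vertices. A leaf-reconstruction of $N$ is a phylogenetic network $N'$ on $X$ with $V(N')=V(N)$ and $N'_x\sim N_x$ for all $x\in X$; $N$ is leaf-reconstructible if every leaf-reconstruction of $N$ is equivalent to $N$. *)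

theory Defs
  imports "HOL-Library.Multiset"
begin

text \<open>
  Multigraphs: an edge is the set of its endpoints, so a loop at \<open>v\<close> is \<open>{v}\<close>,
  and parallel edges are recorded by their multiplicity.
\<close>

record 'a mgraph =
  verts :: "'a set"
  edges :: "'a set multiset"

definition multigraph :: "'a mgraph \<Rightarrow> bool" where
  "multigraph G \<longleftrightarrow> finite (verts G) \<and>
     (\<forall>e\<in>#edges G. e \<subseteq> verts G \<and> (card e = 1 \<or> card e = 2))"

definition simple_graph :: "'a mgraph \<Rightarrow> bool" where
  "simple_graph G \<longleftrightarrow> multigraph G \<and>
     (\<forall>e\<in>#edges G. card e = 2 \<and> count (edges G) e = 1)"

text \<open>A loop contributes two to the degree of its vertex.\<close>

definition degree :: "'a mgraph \<Rightarrow> 'a \<Rightarrow> nat" where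
  "degree G v = size {#e \<in># edges G. v \<in> e#} + count (edges G) {v}"

definition leaves :: "'a mgraph \<Rightarrow> 'a set" where
  "leaves G = {v \<in> verts G. degree G v = 1}"

definition adjacency :: "'a mgraph \<Rightarrow> ('a \<times> 'a) set" where
  "adjacency G = {(u, v). {u, v} \<in># edges G}"

definition connected_graph :: "'a mgraph \<Rightarrow> bool" where
  "connected_graph G \<longleftrightarrow> verts G \<noteq> {} \<and>
     (\<forall>u\<in>verts G. \<forall>v\<in>verts G. (u, v) \<in> (adjacency G)\<^sup>*)"

definition delete_vertex :: "'a mgraph \<Rightarrow> 'a \<Rightarrow> 'a mgraph" where
  "delete_vertex G v = \<lparr>verts = verts G - {v}, edges = {#e \<in># edges G. v \<notin> e#}\<rparr>"

definition delete_edge :: "'a mgraph \<Rightarrow> 'a set \<Rightarrow> 'a mgraph" where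
  "delete_edge G e = \<lparr>verts = verts G, edges = edges G - {#e#}\<rparr>"

definition subgraph :: "'a mgraph \<Rightarrow> 'a mgraph \<Rightarrow> bool" where
  "subgraph H G \<longleftrightarrow> multigraph H \<and> verts H \<subseteq> verts G \<and> edges H \<subseteq># edges G"

definition is_cycle :: "'a mgraph \<Rightarrow> 'a list \<Rightarrow> bool" where
  "is_cycle G vs \<longleftrightarrow> distinct vs \<and> length vs \<ge> 3 \<and>
     (\<forall>i<length vs. {vs ! i, vs ! (Suc i mod length vs)} \<in># edges G)"

definition tree :: "'a mgraph \<Rightarrow> bool" where
  "tree G \<longleftrightarrow> simple_graph G \<and> connected_graph G \<and> (\<nexists>vs. is_cycle G vs)"

text \<open>
  Leaf labels are identified with the leaves themselves: the label set \<open>X\<close> is a set of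
  vertices.
\<close>

definition phylogenetic_tree :: "'a set \<Rightarrow> 'a mgraph \<Rightarrow> bool" where
  "phylogenetic_tree X T \<longleftrightarrow> tree T \<and> (\<forall>v\<in>verts T. degree T v \<noteq> 2) \<and> leaves T = X"

text \<open>
  Connected without a cut-vertex. The graph consisting of a single edge qualifies; it is the
  requirement of two edges that keeps bridges from being blobs.
\<close>

definition two_connected :: "'a mgraph \<Rightarrow> bool" where
  "two_connected G \<longleftrightarrow> connected_graph G \<and>
     (\<forall>v\<in>verts G. verts G \<noteq> {v} \<longrightarrow> connected_graph (delete_vertex G v))"

definition blob :: "'a mgraph \<Rightarrow> 'a mgraph \<Rightarrow> bool" where
  "blob G B \<longleftrightarrow> subgraph B G \<and> two_connected B \<and> size (edges B) \<ge> 2 \<and>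
     (\<forall>H. subgraph H G \<and> two_connected H \<and> subgraph B H \<longrightarrow> H = B)"

text \<open>
  A vertex of the contracted graph is the set of the original vertices that are merged into it:
  a vertex outside all blobs becomes \<open>{v}\<close>, and blobs sharing a vertex end up in the same set.
\<close>

definition blob_class :: "'a mgraph \<Rightarrow> 'a \<Rightarrow> 'a set" where
  "blob_class G v = (\<Union>B\<in>{B. blob G B}. verts B \<times> verts B)\<^sup>* `` {v}"

definition contract_blobs :: "'a mgraph \<Rightarrow> 'a set mgraph" where
  "contract_blobs G =
     \<lparr>verts = blob_class G ` verts G,
      edges = {#blob_class G ` e. e \<in># {#e \<in># edges G. \<nexists>B. blob G B \<and> e \<in># edges B#}#}\<rparr>"

definition phylogenetic_network :: "'a set \<Rightarrow> 'a mgraph \<Rightarrow> bool" where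
  "phylogenetic_network X N \<longleftrightarrow> simple_graph N \<and> connected_graph N \<and>
     phylogenetic_tree ((\<lambda>x. {x}) ` X) (contract_blobs N)"

definition cut_edge :: "'a mgraph \<Rightarrow> 'a set \<Rightarrow> bool" where
  "cut_edge G e \<longleftrightarrow> e \<in># edges G \<and> \<not> connected_graph (delete_edge G e)"

definition trivial_cut_edge :: "'a mgraph \<Rightarrow> 'a set \<Rightarrow> bool" where
  "trivial_cut_edge G e \<longleftrightarrow> cut_edge G e \<and> (\<exists>v\<in>e. v \<in> leaves G)"

definition decomposable :: "'a mgraph \<Rightarrow> bool" where
  "decomposable N \<longleftrightarrow> (\<exists>e. cut_edge N e \<and> \<not> trivial_cut_edge N e)"

definition equivalent :: "'a set \<Rightarrow> 'a mgraph \<Rightarrow> 'a mgraph \<Rightarrow> bool" where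
  "equivalent X G H \<longleftrightarrow>
     (\<exists>f. bij_betw f (verts G) (verts H) \<and> edges H = {#f ` e. e \<in># edges G#} \<and>
          (\<forall>x\<in>X. f x = x))"

text \<open>
  For a vertex \<open>v\<close> whose incident edges are \<open>{v, u}\<close> and \<open>{v, w}\<close>, the new edge is \<open>{u, w}\<close>,
  which is a loop if \<open>u = w\<close>. No edge is created if the only edge at \<open>v\<close> is a loop.
\<close>

definition suppress :: "'a \<Rightarrow> 'a mgraph \<Rightarrow> 'a mgraph" where
  "suppress v G =
     (let e = \<Union> (set_mset {#e \<in># edges G. v \<in> e#}) - {v}
      in \<lparr>verts = verts G - {v},
          edges = {#e \<in># edges G. v \<notin> e#} + (if e = {} then {#} else {#e#})\<rparr>)"

text \<open>The order of suppressions is irrelevant, which justifies the fold below.\<close>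

lemma comp_fun_commute_suppress: "comp_fun_commute (suppress :: 'a \<Rightarrow> _)"
proof
  have adj: "suppress u (suppress w G) =
      (let e = \<Union> {e. e \<in># edges G \<and> (u \<in> e \<or> w \<in> e)} - {u, w}
       in \<lparr>verts = verts G - {u, w},
           edges = {#e \<in># edges G. u \<notin> e \<and> w \<notin> e#} + (if e = {} then {#} else {#e#})\<rparr>)"
    if "u \<noteq> w" and ex: "\<exists>e\<in>#edges G. u \<in> e \<and> w \<in> e" for u w :: 'a and G
  proof -
    define W where "W = \<Union> {e. e \<in># edges G \<and> w \<in> e} - {w}"
    have uW: "u \<in> W" "W \<noteq> {}" using that by (auto simp: W_def)
    have 1: "suppress w G = \<lparr>verts = verts G - {w}, edges = {#e \<in># edges G. w \<notin> e#} + {#W#}\<rparr>"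
      using uW(2) by (simp add: suppress_def Let_def W_def[symmetric])
    have 2: "\<Union> (set_mset {#e \<in># {#e \<in># edges G. w \<notin> e#} + {#W#}. u \<in> e#}) - {u}
        = \<Union> {e. e \<in># edges G \<and> (u \<in> e \<or> w \<in> e)} - {u, w}" (is "?L = ?E")
    proof -
      have "?L = (W \<union> \<Union> {e. e \<in># edges G \<and> w \<notin> e \<and> u \<in> e}) - {u}"
        using uW by simp
      also have "\<dots> = ?E" unfolding W_def by blast
      finally show ?thesis .
    qed
    have 3: "{#e \<in># {#e \<in># edges G. w \<notin> e#} + {#W#}. u \<notin> e#} = {#e \<in># edges G. u \<notin> e \<and> w \<notin> e#}"
      using uW by (simp add: filter_filter_mset conj_commute)
    have 4: "verts G - {w} - {u} = verts G - {u, w}" by blast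
    show ?thesis
      unfolding 1 suppress_def[of u] mgraph.simps 2 3 4 ..
  qed
  have non_adj: "suppress u (suppress w G) =
      \<lparr>verts = verts G - {u, w},
       edges = {#e \<in># edges G. u \<notin> e \<and> w \<notin> e#} + (f u + f w)\<rparr>"
    if "\<not> (\<exists>e\<in>#edges G. u \<in> e \<and> w \<in> e)"
      and f: "f = (\<lambda>v. let e = \<Union> {e. e \<in># edges G \<and> v \<in> e} - {v} in if e = {} then {#} else {#e#})"
    for u w :: 'a and G f
  proof -
    have 1: "suppress w G = \<lparr>verts = verts G - {w}, edges = {#e \<in># edges G. w \<notin> e#} + f w\<rparr>"
      by (simp add: suppress_def Let_def f)
    have ufw: "u \<notin> e" if "e \<in># f w" for e
      using that \<open>\<not> _\<close> by (auto simp: f Let_def split: if_splits)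
    have 2: "{#e \<in># f w. u \<in> e#} = {#}" "{#e \<in># f w. u \<notin> e#} = f w"
      using ufw by (auto simp: multiset_eq_iff count_eq_zero_iff)
    have 3: "{#e \<in># {#e \<in># edges G. w \<notin> e#}. u \<in> e#} = {#e \<in># edges G. u \<in> e#}"
      unfolding filter_filter_mset using that(1) by (intro filter_mset_cong) auto
    have 4: "{#e \<in># {#e \<in># edges G. w \<notin> e#}. u \<notin> e#} = {#e \<in># edges G. u \<notin> e \<and> w \<notin> e#}"
      by (simp add: filter_filter_mset conj_commute)
    have 5: "verts G - {w} - {u} = verts G - {u, w}" by blast
    have 6: "(let e = \<Union> (set_mset {#e \<in># edges G. u \<in> e#}) - {u} in
        \<lparr>verts = V, edges = E + F + (if e = {} then {#} else {#e#})\<rparr>) =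
        \<lparr>verts = V, edges = E + (f u + F)\<rparr>" for V E F
      by (simp add: f Let_def)
    show ?thesis
      unfolding 1 suppress_def[of u] mgraph.simps filter_union_mset 2 3 4 5 add_0_right 6 ..
  qed
  show "suppress u \<circ> suppress w = suppress w \<circ> suppress u" for u w :: 'a
  proof
    fix G
    show "(suppress u \<circ> suppress w) G = (suppress w \<circ> suppress u) G"
    proof (cases "u = w")
      case ne: False
      show ?thesis
      proof (cases "\<exists>e\<in>#edges G. u \<in> e \<and> w \<in> e")
        case True
        then have True': "\<exists>e\<in>#edges G. w \<in> e \<and> u \<in> e" by blast
        show ?thesis
          unfolding comp_apply adj[OF ne True] adj[OF ne[symmetric] True']
          by (simp only: insert_commute disj_commute conj_commute)
      next
        case False
        then have False': "\<not> (\<exists>e\<in>#edges G. w \<in> e \<and> u \<in> e)" by blast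
        show ?thesis
          unfolding comp_apply non_adj[OF False refl] non_adj[OF False' refl]
          by (simp only: insert_commute conj_commute add.commute)
      qed
    qed simp
  qed
qed

text \<open>
  The suppressed vertices are those whose degree becomes two through the deletion. If no vertex
  of \<open>G\<close> has degree two, these are all vertices of degree two.
\<close>

definition delete_suppress :: "'a mgraph \<Rightarrow> 'a \<Rightarrow> 'a mgraph" where
  "delete_suppress G v =
     Finite_Set.fold suppress (delete_vertex G v)
       {w \<in> verts (delete_vertex G v). degree (delete_vertex G v) w = 2 \<and> degree G w \<noteq> 2}"

definition leaf_reconstruction :: "'a set \<Rightarrow> 'a mgraph \<Rightarrow> 'a mgraph \<Rightarrow> bool" where
  "leaf_reconstruction X N N' \<longleftrightarrow> phylogenetic_network X N' \<and> verts N' = verts N \<and>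
     (\<forall>x\<in>X. equivalent (X - {x}) (delete_suppress N' x) (delete_suppress N x))"

definition leaf_reconstructible :: "'a set \<Rightarrow> 'a mgraph \<Rightarrow> bool" where
  "leaf_reconstructible X N \<longleftrightarrow> (\<forall>N'. leaf_reconstruction X N N' \<longrightarrow> equivalent X N' N)"

end

theory Submission
  imports Defs
begin

text \<open>
  A cut-edge is represented by the vertex set \<open>S\<close> of one of its sides: a set crossed by exactly
  one edge. In a phylogenetic network such a set is determined by \<open>S \<inter> X\<close>, since the tree of
  blobs has no vertices of degree two.

  A nontrivial cut-edge of \<open>N\<close> splits \<open>X\<close> into parts \<open>A\<close> and \<open>B\<close> with at least two elements,
  one of them, say \<open>A\<close>, with at least three. For \<open>x \<in> A\<close> the split survives in \<open>N\<^sub>x\<close>, so a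
  reconstruction has a cut-edge with side \<open>B\<close> or \<open>B \<union> {x}\<close>; intersecting the sides obtained from
  two choices of \<open>x\<close> yields, by submodularity, a cut-edge inducing the split itself. The side of
  \<open>B\<close> is the smallest side with trace \<open>B\<close> in \<open>N\<^sub>x\<close>, hence the isomorphism of the graphs \<open>N\<^sub>x\<close>
  maps it correctly and respects the endpoint of the cut-edge; likewise for \<open>A\<close> and \<open>N\<^sub>y\<close> with
  \<open>y \<in> B\<close>. The two isomorphisms of the sides glue along the cut-edge.
\<close>

section \<open>Edge cuts\<close>

definition crossing :: "'a set \<Rightarrow> 'a set \<Rightarrow> bool" where
  "crossing S e \<longleftrightarrow> e \<inter> S \<noteq> {} \<and> \<not> e \<subseteq> S"

definition boundary :: "'a mgraph \<Rightarrow> 'a set \<Rightarrow> 'a set multiset" where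
  "boundary G S = {#e \<in># edges G. crossing S e#}"

definition one_cut :: "'a mgraph \<Rightarrow> 'a set \<Rightarrow> bool" where
  "one_cut G S \<longleftrightarrow> S \<subseteq> verts G \<and> size (boundary G S) = 1"

definition inner_edges :: "'a mgraph \<Rightarrow> 'a set \<Rightarrow> 'a set multiset" where
  "inner_edges G S = {#e \<in># edges G. e \<subseteq> S#}"

definition attachments :: "'a mgraph \<Rightarrow> 'a set \<Rightarrow> 'a set multiset" where
  "attachments G S = {#e \<inter> S. e \<in># boundary G S#}"

lemma size_attachments [simp]: "size (attachments G S) = size (boundary G S)"
  by (simp add: attachments_def)

lemma simple_graph_edge:
  assumes "simple_graph G" "e \<in># edges G"
  obtains a b where "a \<noteq> b" "e = {a, b}" "a \<in> verts G" "b \<in> verts G"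
proof -
  have "e \<subseteq> verts G" "card e = 2"
    using assms by (auto simp: simple_graph_def multigraph_def)
  then show thesis using that by (auto simp: card_2_iff)
qed

lemma simple_graph_edge_subset: "simple_graph G \<Longrightarrow> e \<in># edges G \<Longrightarrow> e \<subseteq> verts G"
  by (auto simp: simple_graph_def multigraph_def)

lemma simple_graph_card: "simple_graph G \<Longrightarrow> e \<in># edges G \<Longrightarrow> card e = 2"
  by (auto simp: simple_graph_def)

lemma simple_graph_degree:
  assumes "simple_graph G"
  shows "degree G v = size {#e \<in># edges G. v \<in> e#}"
proof -
  have "{v} \<notin># edges G"
    using simple_graph_card[OF assms, of "{v}"] by auto
  then show ?thesis by (simp add: degree_def not_in_iff)
qed

lemma filter_eq_singleton:
  assumes "size {#e \<in># M. P e#} = 1"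
  obtains e where "e \<in># M" "P e" "{#e \<in># M. P e#} = {#e#}" "\<And>d. d \<in># M \<Longrightarrow> P d \<Longrightarrow> d = e"
proof -
  obtain e where e: "{#e \<in># M. P e#} = {#e#}"
    using assms size_1_singleton_mset by blast
  then have "set_mset {#e \<in># M. P e#} = {e}" by simp
  then have "{d \<in> set_mset M. P d} = {e}" by simp
  then show thesis using that e by blast
qed

lemma one_cutE:
  assumes "one_cut G S"
  obtains e where "e \<in># edges G" "crossing S e" "boundary G S = {#e#}"
    "\<And>d. d \<in># edges G \<Longrightarrow> crossing S d \<Longrightarrow> d = e"
  using assms filter_eq_singleton[of "crossing S" "edges G"]
  unfolding one_cut_def boundary_def by metis

lemma connected_crossing:
  assumes "connected_graph G" "u \<in> S" "u \<in> verts G" "v \<in> verts G" "v \<notin> S"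
  obtains e where "e \<in># edges G" "crossing S e"
proof (rule ccontr)
  assume "\<not> thesis"
  with that have no: "\<And>e. e \<in># edges G \<Longrightarrow> \<not> crossing S e" by blast
  have "(u, v) \<in> (adjacency G)\<^sup>*"
    using assms by (auto simp: connected_graph_def)
  then have "v \<in> S"
  proof (induction rule: rtrancl_induct)
    case (step y z)
    then have "\<not> crossing S {y, z}" using no by (auto simp: adjacency_def)
    with step.IH show ?case by (auto simp: crossing_def)
  qed (rule assms)
  with assms show False by simp
qed

lemma crossing_Compl:
  assumes "e \<subseteq> V" shows "crossing (V - S) e \<longleftrightarrow> crossing S e"
  using assms by (auto simp: crossing_def)

lemma one_cut_Compl:
  assumes "simple_graph G" "one_cut G S"
  shows "one_cut G (verts G - S)" and "boundary G (verts G - S) = boundary G S"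
proof -
  show *: "boundary G (verts G - S) = boundary G S"
    unfolding boundary_def
    by (rule filter_mset_cong) (auto simp: crossing_Compl simple_graph_edge_subset[OF assms(1)])
  show "one_cut G (verts G - S)"
    using assms(2) * by (auto simp: one_cut_def)
qed

lemma one_cut_proper:
  assumes "one_cut G S" "simple_graph G"
  shows "S \<noteq> {}" "S \<noteq> verts G"
proof -
  from assms(1) obtain e where "e \<in># edges G" "crossing S e" by (rule one_cutE)
  then show "S \<noteq> {}" "S \<noteq> verts G"
    using simple_graph_edge_subset[OF assms(2)] by (auto simp: crossing_def)
qed

lemma boundary_submodular:
  assumes "simple_graph G"
  shows "size (boundary G (S \<inter> T)) + size (boundary G (S \<union> T)) \<le> size (boundary G S) + size (boundary G T)"
proof -
  have "size {#e \<in># M. crossing (S \<inter> T) e#} + size {#e \<in># M. crossing (S \<union> T) e#}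
      \<le> size {#e \<in># M. crossing S e#} + size {#e \<in># M. crossing T e#}"
    if "\<forall>e\<in>#M. card e = 2" for M
    using that
  proof (induction M)
    case (add e M)
    then obtain a b where "e = {a, b}" by (auto simp: card_2_iff)
    then show ?case using add by (auto simp: crossing_def)
  qed simp
  then show ?thesis using simple_graph_card[OF assms] by (simp add: boundary_def)
qed

lemma boundary_diff_le:
  "size (boundary G (S - T)) \<le> size (boundary G S) + size (boundary G T)"
proof -
  have "size {#e \<in># M. crossing (S - T) e#}
      \<le> size {#e \<in># M. crossing S e#} + size {#e \<in># M. crossing T e#}" for M
    by (induction M) (auto simp: crossing_def)
  then show ?thesis by (simp add: boundary_def)
qed

lemma connected_boundary_pos:
  assumes "connected_graph G" "S \<subseteq> verts G" "S \<noteq> {}" "S \<noteq> verts G"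
  shows "size (boundary G S) \<ge> 1"
proof -
  obtain u v where "u \<in> S" "v \<in> verts G" "v \<notin> S" using assms by blast
  then obtain e where "e \<in># edges G" "crossing S e"
    using connected_crossing[OF assms(1)] assms(2) by blast
  then have "e \<in># boundary G S" by (simp add: boundary_def)
  then show ?thesis by (cases "boundary G S") auto
qed

lemma one_cut_Int:
  assumes "simple_graph G" "connected_graph G" "one_cut G S" "one_cut G T"
    and "S \<inter> T \<noteq> {}" "S \<union> T \<noteq> verts G"
  shows "one_cut G (S \<inter> T)"
proof -
  have sub: "S \<subseteq> verts G" "T \<subseteq> verts G" using assms by (auto simp: one_cut_def)
  have "size (boundary G (S \<inter> T)) \<ge> 1"
    using assms(5,6) sub by (intro connected_boundary_pos[OF assms(2)]) auto
  moreover have "size (boundary G (S \<union> T)) \<ge> 1"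
    using assms(5,6) sub by (intro connected_boundary_pos[OF assms(2)]) auto
  moreover have "size (boundary G (S \<inter> T)) + size (boundary G (S \<union> T)) \<le> 2"
    using boundary_submodular[OF assms(1), of S T] assms(3,4) by (simp add: one_cut_def)
  ultimately show ?thesis using sub by (auto simp: one_cut_def)
qed

section \<open>Forests\<close>

lemma acyclic_low_degree_vertex:
  assumes simple: "simple_graph G" and acyc: "\<nexists>vs. is_cycle G vs"
    and D: "finite D" "D \<noteq> {}"
  obtains v where "v \<in> D" "size {#e \<in># edges G. v \<in> e \<and> e \<subseteq> D#} \<le> 1"
proof (rule ccontr)
  assume "\<not> thesis"
  with that have deg: "size {#e \<in># edges G. v \<in> e \<and> e \<subseteq> D#} \<ge> 2" if "v \<in> D" for v
    using \<open>v \<in> D\<close> by (force simp: not_le[symmetric])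
  have nbr: "\<exists>w\<in>D. w \<noteq> v \<and> w \<noteq> z \<and> {v, w} \<in># edges G" if "v \<in> D" for v z
  proof (rule ccontr)
    assume no: "\<not> ?thesis"
    define M where "M = {#e \<in># edges G. v \<in> e \<and> e \<subseteq> D#}"
    have "e = {v, z}" if e: "e \<in># M" for e
    proof -
      have "e \<in># edges G" "v \<in> e" "e \<subseteq> D" using e by (auto simp: M_def)
      with simple obtain a b where "a \<noteq> b" "e = {a, b}" by (blast elim: simple_graph_edge)
      then obtain w where "w \<noteq> v" "e = {v, w}"
        using \<open>v \<in> e\<close> by (metis insertE insert_commute singletonD)
      with no \<open>e \<subseteq> D\<close> \<open>e \<in># edges G\<close> show ?thesis by auto
    qed
    then have "M = replicate_mset (size M) {v, z}"
      by (metis set_mset_subset_singletonD insertCI subsetI)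
    moreover have "size M \<ge> 2" using deg[OF \<open>v \<in> D\<close>] by (simp add: M_def)
    ultimately have "count M {v, z} \<ge> 2" by (metis count_replicate_mset)
    then have c: "count (edges G) {v, z} \<ge> 2" by (auto simp: M_def split: if_splits)
    then have "{v, z} \<in># edges G" by (metis count_eq_zero_iff not_numeral_le_zero)
    with simple c show False by (auto simp: simple_graph_def)
  qed
  define path where "path vs \<longleftrightarrow> vs \<noteq> [] \<and> distinct vs \<and> set vs \<subseteq> D \<and>
     (\<forall>i. Suc i < length vs \<longrightarrow> {vs ! i, vs ! Suc i} \<in># edges G)" for vs
  obtain d where "d \<in> D" using D by blast
  then have "path [d]" by (simp add: path_def)
  moreover have "length vs \<le> card D" if "path vs" for vs
    using that D by (metis card_mono distinct_card path_def)
  ultimately obtain vs where vs: "path vs" and max: "\<And>us. path us \<Longrightarrow> length us \<le> length vs"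
    using ex_has_greatest_nat[of path "[d]" length "Suc (card D)"] by (auto simp: less_Suc_eq_le)
  obtain v r where vr: "vs = v # r" using vs by (cases vs) (auto simp: path_def)
  have "v \<in> D" using vs vr by (simp add: path_def)
  then obtain z where z: "z \<in> D" "z \<noteq> v" "r \<noteq> [] \<longrightarrow> z \<noteq> hd r" "{v, z} \<in># edges G"
    using nbr[of v "hd r"] by blast
  have "z \<in> set vs"
  proof (rule ccontr)
    assume "z \<notin> set vs"
    then have "path (z # vs)"
      using vs z vr by (auto simp: path_def nth_Cons insert_commute split: nat.splits)
    from max[OF this] show False by simp
  qed
  then obtain j where j: "j < length vs" "vs ! j = z" by (auto simp: in_set_conv_nth)
  have "j \<noteq> 0" using j z vr by (metis nth_Cons_0)
  moreover have "j \<noteq> 1" using j z vr by (cases r) auto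
  ultimately have "j \<ge> 2" by linarith
  have "is_cycle G (take (Suc j) vs)"
    unfolding is_cycle_def
  proof (intro conjI allI impI)
    show "distinct (take (Suc j) vs)" using vs by (simp add: path_def)
    show "3 \<le> length (take (Suc j) vs)" using \<open>j \<ge> 2\<close> j by simp
    fix i assume "i < length (take (Suc j) vs)"
    then consider "i < j" | "i = j" using j by fastforce
    then show "{take (Suc j) vs ! i, take (Suc j) vs ! (Suc i mod length (take (Suc j) vs))} \<in># edges G"
    proof cases
      case 1
      then show ?thesis using vs j by (auto simp: path_def)
    next
      case 2
      then have "Suc i mod length (take (Suc j) vs) = 0" using j by (simp add: min_absorb2)
      moreover have "take (Suc j) vs ! i = z" using 2 j by simp
      moreover have "take (Suc j) vs ! 0 = v" using vr by simp
      ultimately show ?thesis using z by (simp add: insert_commute)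
    qed
  qed
  with acyc show False by blast
qed

lemma acyclic_boundary_ge_3:
  assumes simple: "simple_graph G" and acyc: "\<nexists>vs. is_cycle G vs"
    and "finite D" "D \<noteq> {}" "\<And>v. v \<in> D \<Longrightarrow> degree G v \<ge> 3"
  shows "size (boundary G D) \<ge> 3"
  using assms(3-)
proof (induction "card D" arbitrary: D rule: less_induct)
  case less
  obtain v where v: "v \<in> D" "size {#e \<in># edges G. v \<in> e \<and> e \<subseteq> D#} \<le> 1"
    using acyclic_low_degree_vertex[OF simple acyc less.prems(1,2)] by blast
  have deg: "size {#e \<in># edges G. v \<in> e#} \<ge> 3"
    using less.prems(3)[OF v(1)] by (simp add: simple_graph_degree[OF simple])
  have count: "size {#e \<in># M. crossing (D - {v}) e#} + size {#e \<in># M. v \<in> e#}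
      \<le> size {#e \<in># M. crossing D e#} + 2 * size {#e \<in># M. v \<in> e \<and> e \<subseteq> D#}"
    if "\<forall>e\<in>#M. card e = 2" for M
    using that
  proof (induction M)
    case (add e M)
    then obtain a b where "a \<noteq> b" "e = {a, b}" by (auto simp: card_2_iff)
    then show ?case using add v(1) by (auto simp: crossing_def)
  qed simp
  then have count: "size (boundary G (D - {v})) + size {#e \<in># edges G. v \<in> e#}
      \<le> size (boundary G D) + 2 * size {#e \<in># edges G. v \<in> e \<and> e \<subseteq> D#}"
    using simple_graph_card[OF simple] by (simp add: boundary_def)
  show ?case
  proof (cases "D = {v}")
    case True
    have "boundary G D = {#e \<in># edges G. v \<in> e#}"
      unfolding boundary_def
    proof (rule filter_mset_cong)
      fix e assume "e \<in># edges G"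
      then show "crossing D e = (v \<in> e)"
        using simple_graph_card[OF simple, of e] True
        by (auto simp: crossing_def card_2_iff)
    qed simp
    then show ?thesis using deg by simp
  next
    case False
    then have "size (boundary G (D - {v})) \<ge> 3"
      using less.prems v by (intro less.hyps) (auto simp: card_gt_0_iff)
    then show ?thesis using count deg v(2) by linarith
  qed
qed

lemma phylogenetic_tree_leafless_boundary:
  assumes T: "phylogenetic_tree L T" and "one_cut T P"
    and D: "D \<subseteq> verts T" "D \<inter> L = {}" "D \<noteq> {}"
  shows "size (boundary T D) \<ge> 3"
proof -
  have simple: "simple_graph T" and conn: "connected_graph T" and acyc: "\<nexists>vs. is_cycle T vs"
    and no2: "\<And>v. v \<in> verts T \<Longrightarrow> degree T v \<noteq> 2" and L: "leaves T = L"
    using T by (auto simp: phylogenetic_tree_def tree_def)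
  have "finite D"
    using simple D(1) by (auto simp: simple_graph_def multigraph_def intro: finite_subset)
  moreover have "degree T v \<ge> 3" if "v \<in> D" for v
  proof -
    have v: "v \<in> verts T" "v \<notin> leaves T" using that D L by auto
    have "verts T \<noteq> {v}"
      using one_cut_proper[OF assms(2) simple] assms(2) by (auto simp: one_cut_def)
    then have "size (boundary T {v}) \<ge> 1"
      using v by (intro connected_boundary_pos[OF conn]) auto
    moreover have "boundary T {v} \<subseteq># {#e \<in># edges T. v \<in> e#}"
      unfolding boundary_def by (rule filter_mset_mono_strong) (auto simp: crossing_def)
    ultimately have "degree T v \<ge> 1"
      using size_mset_mono by (fastforce simp: simple_graph_degree[OF simple])
    moreover have "degree T v \<noteq> 1" using v by (auto simp: leaves_def)
    ultimately show ?thesis using no2[OF v(1)] by linarith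
  qed
  ultimately show ?thesis using acyclic_boundary_ge_3[OF simple acyc _ D(3)] by blast
qed

lemma phylogenetic_tree_one_cut_trace:
  assumes T: "phylogenetic_tree L T" and P: "one_cut T P"
  shows "P \<inter> L \<noteq> {}"
proof
  assume *: "P \<inter> L = {}"
  have "P \<noteq> {}"
    using one_cut_proper[OF P] T by (auto simp: phylogenetic_tree_def tree_def)
  then have "size (boundary T P) \<ge> 3"
    using phylogenetic_tree_leafless_boundary[OF T P _ *] P by (auto simp: one_cut_def)
  with P show False by (simp add: one_cut_def)
qed

lemma phylogenetic_tree_one_cut_unique:
  assumes T: "phylogenetic_tree L T" and P: "one_cut T P" and Q: "one_cut T Q"
    and "P \<inter> L = Q \<inter> L"
  shows "P = Q"
proof -
  have "P' \<subseteq> Q'" if P': "one_cut T P'" and Q': "one_cut T Q'" and tr: "P' \<inter> L = Q' \<inter> L" for P' Q'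
  proof (rule ccontr)
    assume "\<not> P' \<subseteq> Q'"
    then have "size (boundary T (P' - Q')) \<ge> 3"
      using P' tr by (intro phylogenetic_tree_leafless_boundary[OF T P']) (auto simp: one_cut_def)
    with boundary_diff_le[of T P' Q'] P' Q' show False by (simp add: one_cut_def)
  qed
  with assms show ?thesis by (metis subset_antisym)
qed

section \<open>Cuts of phylogenetic networks\<close>

lemma blob_one_cut_side:
  assumes simple: "simple_graph G" and S: "one_cut G S" and B: "blob G B"
  shows "verts B \<subseteq> S \<or> verts B \<inter> S = {}"
proof (rule ccontr)
  assume "\<not> ?thesis"
  then obtain p q where pq: "p \<in> verts B" "p \<in> S" "q \<in> verts B" "q \<notin> S" by blast
  have sub: "edges B \<subseteq># edges G" and two: "two_connected B" and size: "size (edges B) \<ge> 2"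
    and mB: "multigraph B"
    using B by (auto simp: blob_def subgraph_def)
  have BG: "e \<in># edges G" if "e \<in># edges B" for e
    using that sub by (rule mset_subset_eqD[rotated])
  obtain e where e: "e \<in># edges B" "crossing S e"
    using two pq by (metis connected_crossing two_connected_def)
  have only: "d = e" if "d \<in># edges B" "crossing S d" for d
    using S that BG e by (metis one_cutE)
  obtain a b where ab: "e = {a, b}" "a \<in> S" "b \<notin> S"
    using e BG[OF e(1)] simple by (auto simp: crossing_def elim!: simple_graph_edge)
  have abV: "a \<in> verts B" "b \<in> verts B"
    using e(1) ab mB by (auto simp: multigraph_def)
  have "count (edges B) e \<le> 1"
    using sub BG[OF e(1)] simple
    by (metis mset_subset_eq_count simple_graph_def)
  then have "edges B \<noteq> replicate_mset (size (edges B)) e"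
    using size by (metis count_replicate_mset le_trans numeral_le_one_iff semiring_norm(69))
  then obtain d where d: "d \<in># edges B" "d \<noteq> e"
    by (metis set_mset_subset_singletonD insertCI subsetI)
  obtain c c' where cc: "d = {c, c'}" "c \<noteq> c'"
    using BG[OF d(1)] simple by (auto elim: simple_graph_edge)
  have cV: "c \<in> verts B" "c' \<in> verts B"
    using d(1) cc mB by (auto simp: multigraph_def)
  have "\<not> crossing S d" using only d by blast
  then consider "c \<in> S" "c' \<in> S" | "c \<notin> S" "c' \<notin> S"
    using cc by (auto simp: crossing_def)
  then obtain r s t where rst: "r \<in> e" "r \<in> verts B" "s \<in> verts B - {r}" "s \<in> S"
    "t \<in> verts B - {r}" "t \<notin> S"
  proof cases
    case 1
    then obtain c'' where "c'' \<in> verts B" "c'' \<in> S" "c'' \<noteq> a"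
      using cc cV by metis
    then show thesis using that[of a c'' b] ab abV by auto
  next
    case 2
    then obtain c'' where "c'' \<in> verts B" "c'' \<notin> S" "c'' \<noteq> b"
      using cc cV by metis
    then show thesis using that[of b a c''] ab abV by auto
  qed
  have "connected_graph (delete_vertex B r)"
    using two rst(2,3) by (auto simp: two_connected_def)
  then obtain h where "h \<in># edges (delete_vertex B r)" "crossing S h"
    using rst by (auto simp: delete_vertex_def elim: connected_crossing)
  then have "h \<in># edges B" "r \<notin> h" by (auto simp: delete_vertex_def)
  with only[OF this(1) \<open>crossing S h\<close>] rst(1) show False by simp
qed

lemma blob_class_self: "v \<in> blob_class G v"
  by (simp add: blob_class_def)

lemma blob_class_blob: "blob G B \<Longrightarrow> u \<in> verts B \<Longrightarrow> v \<in> verts B \<Longrightarrow> u \<in> blob_class G v"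
  by (auto simp: blob_class_def)

lemma blob_class_one_cut_side:
  assumes "simple_graph G" "one_cut G S" "v \<in> S"
  shows "blob_class G v \<subseteq> S"
proof
  fix u assume "u \<in> blob_class G v"
  then have "(v, u) \<in> (\<Union>B\<in>{B. blob G B}. verts B \<times> verts B)\<^sup>*" by (simp add: blob_class_def)
  then show "u \<in> S"
    by (induction rule: rtrancl_induct) (use assms blob_one_cut_side in blast)+
qed

lemma blob_class_image_iff:
  assumes "simple_graph G" "one_cut G S"
  shows "blob_class G v \<in> blob_class G ` S \<longleftrightarrow> v \<in> S"
proof
  assume "blob_class G v \<in> blob_class G ` S"
  then obtain s where "s \<in> S" "blob_class G v = blob_class G s" by blast
  then show "v \<in> S"
    using blob_class_one_cut_side[OF assms, of s] blob_class_self[of v G] by auto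
qed (rule imageI)

lemma one_cut_contract_blobs:
  assumes simple: "simple_graph G" and S: "one_cut G S"
  shows "one_cut (contract_blobs G) (blob_class G ` S)"
proof -
  have cr: "crossing (blob_class G ` S) (blob_class G ` e) \<longleftrightarrow> crossing S e" for e
  proof -
    have *: "f ` e \<inter> U \<noteq> {} \<longleftrightarrow> (\<exists>v\<in>e. f v \<in> U)" for f :: "'a \<Rightarrow> 'a set" and U by blast
    show ?thesis
      unfolding crossing_def * image_subset_iff blob_class_image_iff[OF assms] by blast
  qed
  have nb: "\<nexists>B. blob G B \<and> e \<in># edges B" if "crossing S e" for e
  proof
    assume "\<exists>B. blob G B \<and> e \<in># edges B"
    then obtain B where B: "blob G B" "e \<in># edges B" by blast
    then have "e \<subseteq> verts B" by (auto simp: blob_def subgraph_def multigraph_def)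
    with blob_one_cut_side[OF assms B(1)] that show False by (auto simp: crossing_def)
  qed
  have "boundary (contract_blobs G) (blob_class G ` S) = {#blob_class G ` e. e \<in># boundary G S#}"
    unfolding boundary_def contract_blobs_def mgraph.simps filter_mset_image_mset
      cr filter_filter_mset
    by (intro arg_cong2[where f = image_mset] refl filter_mset_cong)
      (use nb in auto)
  then show ?thesis using S by (auto simp: one_cut_def contract_blobs_def)
qed

lemma phylogenetic_network_blob_class_leaf:
  assumes "phylogenetic_network X N" "x \<in> X"
  shows "x \<in> verts N" "blob_class N x = {x}"
proof -
  have "{x} \<in> verts (contract_blobs N)"
    using assms by (auto simp: phylogenetic_network_def phylogenetic_tree_def leaves_def)
  then obtain v where "v \<in> verts N" "{x} = blob_class N v" by (auto simp: contract_blobs_def)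
  moreover have "v = x" using calculation(2) blob_class_self[of v N] by blast
  ultimately show "x \<in> verts N" "blob_class N x = {x}" by simp_all
qed

lemma phylogenetic_network_degree_leaf:
  assumes N: "phylogenetic_network X N" and x: "x \<in> X"
  shows "degree N x = 1"
proof -
  note cl = phylogenetic_network_blob_class_leaf(2)[OF N x]
  have simple: "simple_graph N" "simple_graph (contract_blobs N)"
    using N by (auto simp: phylogenetic_network_def phylogenetic_tree_def tree_def)
  have mem: "{x} \<in> blob_class N ` e \<longleftrightarrow> x \<in> e" for e
  proof
    assume "{x} \<in> blob_class N ` e"
    then obtain v where "v \<in> e" "blob_class N v = {x}" by auto
    then show "x \<in> e" using blob_class_self[of v N] by simp
  qed (use cl in force)
  have nb: "\<nexists>B. blob N B \<and> e \<in># edges B" if e: "e \<in># edges N" "x \<in> e" for e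
  proof
    assume "\<exists>B. blob N B \<and> e \<in># edges B"
    then obtain B where B: "blob N B" "e \<in># edges B" by blast
    then have "e \<subseteq> verts B" by (auto simp: blob_def subgraph_def multigraph_def)
    then have "e \<subseteq> {x}" using blob_class_blob[OF B(1)] cl e by blast
    then have "card e \<le> 1" using card_mono[of "{x}" e] by simp
    then show False using simple_graph_card[OF simple(1) e(1)] by simp
  qed
  have "{#e \<in># edges (contract_blobs N). {x} \<in> e#} = {#blob_class N ` e. e \<in># {#e \<in># edges N. x \<in> e#}#}"
    unfolding contract_blobs_def mgraph.simps filter_mset_image_mset mem filter_filter_mset
    by (intro arg_cong2[where f = image_mset] refl filter_mset_cong) (use nb in auto)
  then have "degree (contract_blobs N) {x} = degree N x"
    by (simp add: simple_graph_degree simple)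
  moreover have "degree (contract_blobs N) {x} = 1"
    using N x by (auto simp: phylogenetic_network_def phylogenetic_tree_def leaves_def)
  ultimately show ?thesis by simp
qed

text \<open>
  The only properties of phylogenetic networks that the reconstruction argument needs:
  distinct cut-edges induce distinct splits of \<open>X\<close>, both of whose parts are nonempty.
\<close>

locale cut_separated_network =
  fixes X :: "'a set" and N :: "'a mgraph"
  assumes simple: "simple_graph N"
    and connected: "connected_graph N"
    and leaf_vert: "x \<in> X \<Longrightarrow> x \<in> verts N"
    and leaf_degree: "x \<in> X \<Longrightarrow> degree N x = 1"
    and one_cut_trace: "one_cut N S \<Longrightarrow> S \<inter> X \<noteq> {}"
    and one_cut_unique: "one_cut N S \<Longrightarrow> one_cut N T \<Longrightarrow> S \<inter> X = T \<inter> X \<Longrightarrow> S = T"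
    and card_leaves: "card X \<ge> 3"

lemma phylogenetic_network_cut_separated:
  assumes N: "phylogenetic_network X N" and "card X \<ge> 3"
  shows "cut_separated_network X N"
proof
  show simple: "simple_graph N" and "connected_graph N"
    using N by (auto simp: phylogenetic_network_def)
  define T where "T = contract_blobs N"
  have T: "phylogenetic_tree ((\<lambda>x. {x}) ` X) T"
    using N by (simp add: phylogenetic_network_def T_def)
  have tr: "blob_class N ` S \<inter> (\<lambda>x. {x}) ` X = (\<lambda>x. {x}) ` (S \<inter> X)" if "one_cut N S" for S
  proof -
    have "{x} \<in> blob_class N ` S \<longleftrightarrow> x \<in> S" if "x \<in> X" for x
      using blob_class_image_iff[OF simple \<open>one_cut N S\<close>, of x]
        phylogenetic_network_blob_class_leaf(2)[OF N that] by simp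
    then show ?thesis by blast
  qed
  show "S \<inter> X \<noteq> {}" if S: "one_cut N S" for S
    using phylogenetic_tree_one_cut_trace[OF T] one_cut_contract_blobs[OF simple S] tr[OF S]
    by (auto simp: T_def)
  show "S = S'" if S: "one_cut N S" and S': "one_cut N S'" and eq: "S \<inter> X = S' \<inter> X" for S S'
  proof -
    have "blob_class N ` S = blob_class N ` S'"
      using phylogenetic_tree_one_cut_unique[OF T] one_cut_contract_blobs[OF simple]
        S S' eq tr[OF S] tr[OF S'] by (simp add: T_def)
    then have "v \<in> S \<longleftrightarrow> v \<in> S'" for v
      using blob_class_image_iff[OF simple S, of v] blob_class_image_iff[OF simple S', of v] by simp
    then show ?thesis by blast
  qed
  show "card X \<ge> 3" by (rule assms)
qed (fact phylogenetic_network_blob_class_leaf(1)[OF N] phylogenetic_network_degree_leaf[OF N])+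

section \<open>Deleting a leaf\<close>

lemma simple_graph_boundary_unique:
  assumes "simple_graph G" "boundary G S \<noteq> {#}" "\<And>d. d \<in># edges G \<Longrightarrow> crossing S d \<Longrightarrow> d = e"
  shows "boundary G S = {#e#}"
proof -
  have "set_mset (boundary G S) \<subseteq> {e}" using assms(3) by (auto simp: boundary_def)
  then have rep: "boundary G S = replicate_mset (size (boundary G S)) e"
    by (rule set_mset_subset_singletonD)
  have "e \<in># boundary G S"
    using assms(2) \<open>set_mset (boundary G S) \<subseteq> {e}\<close> by (metis multiset_nonemptyE singletonD subsetD)
  then have "e \<in># edges G" "crossing S e" by (auto simp: boundary_def)
  then have "count (boundary G S) e = 1" using assms(1) by (simp add: boundary_def simple_graph_def)
  then show ?thesis using rep by (metis One_nat_def count_replicate_mset replicate_mset_0 replicate_mset_Suc)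
qed

lemma cut_edge_one_cut:
  assumes simple: "simple_graph G" and conn: "connected_graph G" and e: "cut_edge G e"
  obtains S where "S \<subseteq> verts G" "boundary G S = {#e#}"
proof -
  define R where "R = (adjacency (delete_edge G e))\<^sup>*"
  obtain u v where uv: "u \<in> verts G" "v \<in> verts G" "(u, v) \<notin> R"
    using e conn by (auto simp: cut_edge_def connected_graph_def delete_edge_def R_def)
  define S where "S = {z \<in> verts G. (u, z) \<in> R}"
  have "d = e" if d: "d \<in># edges G" "crossing S d" for d
  proof (rule ccontr)
    assume "d \<noteq> e"
    from simple d(1) obtain a b where ab: "d = {a, b}" "a \<in> verts G" "b \<in> verts G"
      by (rule simple_graph_edge)
    then obtain a b where ab: "d = {a, b}" "a \<in> S" "b \<in> verts G" "b \<notin> S"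
      using d(2) by (auto simp: crossing_def)
    have "(a, b) \<in> adjacency (delete_edge G e)"
      using d(1) ab(1) \<open>d \<noteq> e\<close> by (auto simp: adjacency_def delete_edge_def in_diff_count)
    moreover have "(u, a) \<in> R" using ab(2) by (simp add: S_def)
    ultimately have "(u, b) \<in> R" by (auto simp: R_def)
    with ab show False by (simp add: S_def)
  qed
  moreover have "boundary G S \<noteq> {#}"
  proof -
    have "u \<in> S" "v \<notin> S" using uv by (auto simp: S_def R_def)
    then have "size (boundary G S) \<ge> 1"
      using uv by (intro connected_boundary_pos[OF conn]) (auto simp: S_def)
    then show ?thesis by auto
  qed
  ultimately have "boundary G S = {#e#}"
    using simple_graph_boundary_unique[OF simple] by blast
  then show thesis by (rule that[rotated]) (auto simp: S_def)
qed

definition pendant :: "'a mgraph \<Rightarrow> 'a \<Rightarrow> 'a \<Rightarrow> bool" where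
  "pendant G x w \<longleftrightarrow> x \<noteq> w \<and> {#e \<in># edges G. x \<in> e#} = {#{x, w}#}"

lemma pendant_edge_iff:
  assumes "pendant G x w" "e \<in># edges G"
  shows "x \<in> e \<longleftrightarrow> e = {x, w}"
proof
  assume "x \<in> e"
  moreover have eq: "{#e \<in># edges G. x \<in> e#} = {#{x, w}#}" using assms(1) by (simp only: pendant_def)
  ultimately have "e \<in># {#{x, w}#}" using assms(2) unfolding eq[symmetric] by simp
  then show "e = {x, w}" by simp
qed simp

lemma pendant_edge: "pendant G x w \<Longrightarrow> {x, w} \<in># edges G"
  by (metis pendant_def multi_member_last multiset_filter_subset mset_subset_eqD)

lemma delete_suppress_pendant:
  assumes simple: "simple_graph G" and x: "pendant G x w"
  obtains (keep) F where "edges G = add_mset {x, w} F" "\<forall>e\<in>#F. x \<notin> e"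
      "delete_suppress G x = \<lparr>verts = verts G - {x}, edges = F\<rparr>"
  | (suppress) F p q where "edges G = F + {#{x, w}, {w, p}, {w, q}#}" "\<forall>e\<in>#F. x \<notin> e \<and> w \<notin> e"
      "p \<noteq> q" "p \<notin> {x, w}" "q \<notin> {x, w}"
      "delete_suppress G x = \<lparr>verts = verts G - {x, w}, edges = add_mset {p, q} F\<rparr>"
proof -
  define F where "F = {#e \<in># edges G. x \<notin> e#}"
  have EF: "edges G = add_mset {x, w} F"
  proof -
    have "edges G = {#e \<in># edges G. x \<in> e#} + F"
      unfolding F_def by (rule multiset_partition)
    also have "\<dots> = {#{x, w}#} + F" using x by (simp only: pendant_def)
    finally show ?thesis by simp
  qed
  have xF: "x \<notin> e" "card e = 2" if "e \<in># F" for e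
    using that simple_graph_card[OF simple] by (auto simp: F_def)
  define G1 where "G1 = delete_vertex G x"
  have G1: "G1 = \<lparr>verts = verts G - {x}, edges = F\<rparr>"
    by (simp add: G1_def delete_vertex_def F_def)
  have deg1: "degree G1 z = size {#e \<in># F. z \<in> e#}" for z
  proof -
    have "{z} \<notin># F" using xF(2)[of "{z}"] by auto
    then show ?thesis by (simp add: degree_def G1 not_in_iff)
  qed
  define W where "W = {z \<in> verts G1. degree G1 z = 2 \<and> degree G z \<noteq> 2}"
  have ds: "delete_suppress G x = Finite_Set.fold suppress G1 W"
    by (simp add: delete_suppress_def G1_def W_def)
  have "W \<subseteq> {w}"
  proof
    fix z assume z: "z \<in> W"
    show "z \<in> {w}"
    proof (rule ccontr)
      assume "z \<notin> {w}"
      moreover have "z \<noteq> x" using z by (auto simp: W_def G1)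
      ultimately have "degree G z = degree G1 z"
        by (simp add: simple_graph_degree[OF simple] deg1 EF)
      with z show False by (simp add: W_def)
    qed
  qed
  then consider "W = {}" | "W = {w}" by blast
  then show thesis
  proof cases
    case 1
    then have "delete_suppress G x = G1" by (simp add: ds)
    with keep[of F] EF xF G1 show thesis by simp
  next
    case 2
    interpret comp_fun_commute "suppress :: 'a \<Rightarrow> _" by (rule comp_fun_commute_suppress)
    have dsw: "delete_suppress G x = suppress w G1"
      using 2 by (simp add: ds)
    have "size {#e \<in># F. w \<in> e#} = 2" using 2 deg1 by (auto simp: W_def)
    then obtain d D where dD: "{#e \<in># F. w \<in> e#} = add_mset d D" "size D = 1"
      using size_eq_Suc_imp_eq_union[of "{#e \<in># F. w \<in> e#}" 1] by auto
    obtain d' where "D = {#d'#}" using size_1_singleton_mset[OF dD(2)] by blast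
    with dD(1) have dd: "{#e \<in># F. w \<in> e#} = {#d, d'#}" by simp
    then have "d \<in># {#e \<in># F. w \<in> e#}" "d' \<in># {#e \<in># F. w \<in> e#}" by simp_all
    then have mem: "d \<in># F" "w \<in> d" "d' \<in># F" "w \<in> d'" by simp_all
    obtain p where p: "d = {w, p}" "p \<noteq> w"
      using xF(2)[OF mem(1)] mem(2) by (auto simp: card_2_iff)
    obtain q where q: "d' = {w, q}" "q \<noteq> w"
      using xF(2)[OF mem(3)] mem(4) by (auto simp: card_2_iff)
    have "d \<noteq> d'"
    proof
      assume "d = d'"
      then have "count {#e \<in># F. w \<in> e#} d = 2" using dd by simp
      then have "count F d = 2" using mem by simp
      moreover have "count (edges G) d = 1" using simple mem EF by (simp add: simple_graph_def)
      ultimately show False using EF by (auto split: if_splits)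
    qed
    then have pq: "p \<noteq> q" using p q by blast
    have pqx: "p \<noteq> x" "q \<noteq> x" using xF(1)[OF mem(1)] xF(1)[OF mem(3)] p q by auto
    define F' where "F' = {#e \<in># F. w \<notin> e#}"
    have FF': "F = F' + {#{w, p}, {w, q}#}"
      using multiset_partition[of F "\<lambda>e. w \<in> e"] dd p q by (simp add: F'_def)
    have "\<Union> (set_mset {#e \<in># F. w \<in> e#}) - {w} = {p, q}"
      using p q unfolding dd by auto
    then have "suppress w G1 = \<lparr>verts = verts G - {x} - {w}, edges = add_mset {p, q} F'\<rparr>"
      by (simp add: suppress_def G1 F'_def)
    moreover have "verts G - {x} - {w} = verts G - {x, w}" by blast
    ultimately have ds': "delete_suppress G x = \<lparr>verts = verts G - {x, w}, edges = add_mset {p, q} F'\<rparr>"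
      using dsw by simp
    have EF': "edges G = F' + {#{x, w}, {w, p}, {w, q}#}" using EF FF' by simp
    have "\<forall>e\<in>#F'. x \<notin> e \<and> w \<notin> e" using xF(1) by (auto simp: F'_def)
    from suppress[OF EF' this pq _ _ ds'] pqx p(2) q(2) show thesis by simp
  qed
qed

lemma delete_suppress_verts:
  assumes "simple_graph G" "pendant G x w"
  shows "verts G - {x, w} \<subseteq> verts (delete_suppress G x)" "x \<notin> verts (delete_suppress G x)"
  by (rule delete_suppress_pendant[OF assms]; auto)+

lemma delete_suppress_edges:
  assumes simple: "simple_graph G" and x: "pendant G x w" and e: "e \<in># edges (delete_suppress G x)"
  shows "e \<subseteq> verts (delete_suppress G x)"
proof -
  have sub: "d \<subseteq> verts G" if "d \<in># edges G" for d
    using simple_graph_edge_subset[OF simple that] .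
  show ?thesis
  proof (rule delete_suppress_pendant[OF simple x])
    fix F assume "edges G = add_mset {x, w} F" "\<forall>e\<in>#F. x \<notin> e"
      "delete_suppress G x = \<lparr>verts = verts G - {x}, edges = F\<rparr>"
    then show ?thesis using e sub[of e] by auto
  next
    fix F p q assume *: "edges G = F + {#{x, w}, {w, p}, {w, q}#}" "\<forall>e\<in>#F. x \<notin> e \<and> w \<notin> e"
      "p \<notin> {x, w}" "q \<notin> {x, w}"
      "delete_suppress G x = \<lparr>verts = verts G - {x, w}, edges = add_mset {p, q} F\<rparr>"
    then have "p \<in> verts G" "q \<in> verts G" using sub[of "{w, p}"] sub[of "{w, q}"] by auto
    then show ?thesis using e sub[of e] * by auto
  qed
qed

lemma one_cut_delete_suppress:
  assumes simple: "simple_graph G" and x: "pendant G x w"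
    and S: "one_cut G S" "x \<notin> S" "w \<notin> S"
  shows "S \<subseteq> verts (delete_suppress G x)"
    and "inner_edges (delete_suppress G x) S = inner_edges G S"
    and "attachments (delete_suppress G x) S = attachments G S"
proof -
  show "S \<subseteq> verts (delete_suppress G x)"
    using delete_suppress_verts[OF simple x] S by (auto simp: one_cut_def)
  have "inner_edges (delete_suppress G x) S = inner_edges G S \<and>
    attachments (delete_suppress G x) S = attachments G S"
  proof (rule delete_suppress_pendant[OF simple x])
    fix F assume *: "edges G = add_mset {x, w} F"
      "delete_suppress G x = \<lparr>verts = verts G - {x}, edges = F\<rparr>"
    then show ?thesis
      using S by (simp add: inner_edges_def attachments_def boundary_def crossing_def)
  next
    fix F p q assume *: "edges G = F + {#{x, w}, {w, p}, {w, q}#}"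
      "delete_suppress G x = \<lparr>verts = verts G - {x, w}, edges = add_mset {p, q} F\<rparr>"
    have "\<not> (p \<in> S \<and> q \<in> S)"
      using S *(1) by (auto simp: one_cut_def boundary_def crossing_def)
    then show ?thesis
      using S * by (auto simp: inner_edges_def attachments_def boundary_def crossing_def)
  qed
  then show "inner_edges (delete_suppress G x) S = inner_edges G S"
    and "attachments (delete_suppress G x) S = attachments G S" by blast+
qed

lemma one_cut_delete_suppress_lift:
  assumes simple: "simple_graph G" and x: "pendant G x w" and xw: "x \<in> verts G" "w \<in> verts G"
    and Y: "one_cut (delete_suppress G x) Y"
  obtains Z where "one_cut G Z" "Y \<subseteq> Z" "Z \<subseteq> Y \<union> {x, w}"
proof (rule delete_suppress_pendant[OF simple x])
  fix F assume *: "edges G = add_mset {x, w} F" "\<forall>e\<in>#F. x \<notin> e"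
    "delete_suppress G x = \<lparr>verts = verts G - {x}, edges = F\<rparr>"
  have YV: "Y \<subseteq> verts G" "x \<notin> Y" and size: "size {#e \<in># F. crossing Y e#} = 1"
    using Y * by (auto simp: one_cut_def boundary_def)
  show thesis
  proof (cases "w \<in> Y")
    case True
    have "{#e \<in># F. crossing (insert x Y) e#} = {#e \<in># F. crossing Y e#}"
      by (rule filter_mset_cong) (use *(2) in \<open>auto simp: crossing_def\<close>)
    then have "one_cut G (insert x Y)"
      using True YV size xw by (simp add: one_cut_def boundary_def *(1)) (simp add: crossing_def)
    with that[of "insert x Y"] show thesis by blast
  next
    case False
    then have "one_cut G Y"
      using YV size by (simp add: one_cut_def boundary_def *(1)) (simp add: crossing_def)
    with that[of Y] show thesis by blast
  qed
next
  fix F p q assume *: "edges G = F + {#{x, w}, {w, p}, {w, q}#}" "\<forall>e\<in>#F. x \<notin> e \<and> w \<notin> e"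
      "p \<noteq> q" "p \<notin> {x, w}" "q \<notin> {x, w}"
      "delete_suppress G x = \<lparr>verts = verts G - {x, w}, edges = add_mset {p, q} F\<rparr>"
  have YV: "Y \<subseteq> verts G" "x \<notin> Y" "w \<notin> Y" and size: "size {#e \<in># add_mset {p, q} F. crossing Y e#} = 1"
    using Y * by (auto simp: one_cut_def boundary_def)
  show thesis
  proof (cases "p \<in> Y \<and> q \<in> Y")
    case True
    have "{#e \<in># F. crossing (insert x (insert w Y)) e#} = {#e \<in># F. crossing Y e#}"
      by (rule filter_mset_cong) (use *(2) in \<open>auto simp: crossing_def\<close>)
    moreover have "\<not> crossing Y {p, q}" "\<not> crossing (insert x (insert w Y)) {x, w}"
      "\<not> crossing (insert x (insert w Y)) {w, p}" "\<not> crossing (insert x (insert w Y)) {w, q}"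
      using True by (auto simp: crossing_def)
    ultimately have "one_cut G (insert x (insert w Y))"
      using YV size xw by (simp add: one_cut_def boundary_def *(1))
    with that[of "insert x (insert w Y)"] show thesis by blast
  next
    case False
    have "\<not> crossing Y {x, w}" using YV by (auto simp: crossing_def)
    moreover have "crossing Y {p, q} \<longleftrightarrow> p \<in> Y \<or> q \<in> Y" "crossing Y {w, p} \<longleftrightarrow> p \<in> Y"
      "crossing Y {w, q} \<longleftrightarrow> q \<in> Y"
      using YV False by (auto simp: crossing_def)
    ultimately have "one_cut G Y"
      using YV size False by (auto simp: one_cut_def boundary_def *(1))
    with that[of Y] show thesis by blast
  qed
qed

section \<open>Transporting and gluing\<close>

lemma isomorphism_cut:
  assumes f: "bij_betw f (verts G) (verts H)" and E: "edges H = {#f ` e. e \<in># edges G#}"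
    and sub: "\<And>e. e \<in># edges G \<Longrightarrow> e \<subseteq> verts G" and S: "S \<subseteq> verts G"
  shows "inner_edges H (f ` S) = {#f ` e. e \<in># inner_edges G S#}"
    and "attachments H (f ` S) = {#f ` e. e \<in># attachments G S#}"
    and "one_cut H (f ` S) \<longleftrightarrow> one_cut G S"
proof -
  have inj: "inj_on f (verts G)" using f by (simp add: bij_betw_def)
  have ss: "f ` e \<subseteq> f ` S \<longleftrightarrow> e \<subseteq> S" if "e \<in># edges G" for e
    using inj sub[OF that] S unfolding inj_on_def by blast
  have Int: "f ` e \<inter> f ` S = f ` (e \<inter> S)" if "e \<in># edges G" for e
    using inj_on_image_Int[OF inj sub[OF that] S] by simp
  show "inner_edges H (f ` S) = {#f ` e. e \<in># inner_edges G S#}"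
    unfolding inner_edges_def E filter_mset_image_mset
    by (intro arg_cong2[where f = image_mset] refl filter_mset_cong) (use ss in auto)
  have b: "boundary H (f ` S) = {#f ` e. e \<in># boundary G S#}"
    unfolding boundary_def E filter_mset_image_mset
    by (intro arg_cong2[where f = image_mset] refl filter_mset_cong)
      (use ss Int in \<open>auto simp: crossing_def\<close>)
  show "attachments H (f ` S) = {#f ` e. e \<in># attachments G S#}"
    unfolding attachments_def b image_mset.compositionality
    by (rule image_mset_cong) (use Int in \<open>auto simp: boundary_def\<close>)
  have "f ` S \<subseteq> verts H" using f S by (auto simp: bij_betw_def)
  then show "one_cut H (f ` S) \<longleftrightarrow> one_cut G S" using S by (simp add: one_cut_def b)
qed

lemma edges_partition_cut:
  assumes "simple_graph G"
  shows "edges G = inner_edges G S + inner_edges G (verts G - S) + boundary G S"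
proof (rule multiset_eqI)
  fix e
  show "count (edges G) e = count (inner_edges G S + inner_edges G (verts G - S) + boundary G S) e"
  proof (cases "e \<in># edges G")
    case True
    then obtain a b where "e = {a, b}" "a \<in> verts G" "b \<in> verts G"
      by (rule simple_graph_edge[OF assms])
    then show ?thesis by (auto simp: inner_edges_def boundary_def crossing_def)
  next
    case False
    then show ?thesis by (auto simp: inner_edges_def boundary_def not_in_iff)
  qed
qed

lemma equivalent_glue:
  assumes simple: "simple_graph G" "simple_graph H" and cuts: "one_cut G R" "one_cut H S"
    and f: "bij_betw f R S" "\<And>x. x \<in> X \<inter> R \<Longrightarrow> f x = x"
      "inner_edges H S = {#f ` e. e \<in># inner_edges G R#}"
      "attachments H S = {#f ` e. e \<in># attachments G R#}"
    and g: "bij_betw g (verts G - R) (verts H - S)" "\<And>x. x \<in> X - R \<Longrightarrow> g x = x"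
      "inner_edges H (verts H - S) = {#g ` e. e \<in># inner_edges G (verts G - R)#}"
      "attachments H (verts H - S) = {#g ` e. e \<in># attachments G (verts G - R)#}"
  shows "equivalent X G H"
proof -
  define h where "h v = (if v \<in> R then f v else g v)" for v
  have hf: "h ` e = f ` e" if "e \<subseteq> R" for e using that by (auto simp: h_def image_iff)
  have hg: "h ` e = g ` e" if "e \<subseteq> verts G - R" for e
    using that by (intro image_cong) (auto simp: h_def)
  have sub: "R \<subseteq> verts G" "S \<subseteq> verts H" using cuts by (auto simp: one_cut_def)
  have "bij_betw h (R \<union> (verts G - R)) (S \<union> (verts H - S))"
  proof (rule bij_betw_combine)
    show "bij_betw h R S"
      using f(1) by (rule bij_betw_cong[THEN iffD1, rotated]) (simp add: h_def)
    show "bij_betw h (verts G - R) (verts H - S)"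
      using g(1) by (rule bij_betw_cong[THEN iffD1, rotated]) (simp add: h_def)
  qed blast
  moreover have "R \<union> (verts G - R) = verts G" "S \<union> (verts H - S) = verts H" using sub by auto
  ultimately have bij: "bij_betw h (verts G) (verts H)" by simp
  obtain d where d: "d \<in># edges G" "boundary G R = {#d#}" using cuts(1) by (rule one_cutE)
  obtain e where e: "e \<in># edges H" "boundary H S = {#e#}" using cuts(2) by (rule one_cutE)
  have dV: "d \<subseteq> verts G" "e \<subseteq> verts H"
    using simple_graph_edge_subset simple d(1) e(1) by blast+
  have "e \<inter> S = f ` (d \<inter> R)"
    using f(4) by (simp add: attachments_def d e)
  moreover have "e \<inter> (verts H - S) = g ` (d \<inter> (verts G - R))"
    using g(4) by (simp add: attachments_def d e one_cut_Compl(2)[OF simple(1) cuts(1)]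
        one_cut_Compl(2)[OF simple(2) cuts(2)])
  ultimately have "(e \<inter> S) \<union> (e \<inter> (verts H - S)) = h ` (d \<inter> R) \<union> h ` (d \<inter> (verts G - R))"
    by (simp add: hf hg)
  moreover have "(e \<inter> S) \<union> (e \<inter> (verts H - S)) = e" "(d \<inter> R) \<union> (d \<inter> (verts G - R)) = d"
    using dV by auto
  ultimately have eh: "e = h ` d" by (metis image_Un)
  have "{#h ` e. e \<in># inner_edges G R#} = inner_edges H S"
    unfolding f(3) by (rule image_mset_cong) (auto simp: inner_edges_def hf)
  moreover have "{#h ` e. e \<in># inner_edges G (verts G - R)#} = inner_edges H (verts H - S)"
    unfolding g(3) by (rule image_mset_cong) (use hg in \<open>auto simp: inner_edges_def\<close>)
  ultimately have "edges H = {#h ` e. e \<in># edges G#}"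
    using edges_partition_cut[OF simple(1), of R] edges_partition_cut[OF simple(2), of S]
    by (simp add: d e eh)
  moreover have "h x = x" if "x \<in> X" for x
    using that f(2) g(2) by (simp add: h_def)
  ultimately show ?thesis using bij by (auto simp: equivalent_def)
qed

section \<open>Reconstruction\<close>

context cut_separated_network
begin

lemma leaf_pendant:
  assumes "x \<in> X"
  obtains w where "pendant N x w" "w \<in> verts N"
proof -
  have "size {#e \<in># edges N. x \<in> e#} = 1"
    using leaf_degree[OF assms] by (simp add: simple_graph_degree[OF simple])
  then obtain e where e: "e \<in># edges N" "x \<in> e" "{#e \<in># edges N. x \<in> e#} = {#e#}"
    by (rule filter_eq_singleton)
  obtain a b where "a \<noteq> b" "e = {a, b}" "a \<in> verts N" "b \<in> verts N"
    using simple e(1) by (rule simple_graph_edge)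
  then obtain w where "w \<noteq> x" "e = {x, w}" "w \<in> verts N"
    using e(2) by (metis insertE insert_commute singletonD)
  then show thesis using that[of w] e(3) by (simp add: pendant_def)
qed

lemma pendant_not_leaf:
  assumes x: "x \<in> X" "pendant N x w"
  shows "w \<notin> X"
proof
  assume "w \<in> X"
  then obtain z where z: "pendant N w z" by (rule leaf_pendant)
  have "{x, w} \<in># edges N" by (rule pendant_edge[OF x(2)])
  then have "{x, w} = {w, z}" using pendant_edge_iff[OF z] by blast
  then have "z = x" using x(2) by (auto simp: pendant_def doubleton_eq_iff)
  have "\<not> crossing {x, w} e" if "e \<in># edges N" for e
    using pendant_edge_iff[OF x(2) that] pendant_edge_iff[OF z that] \<open>z = x\<close>
    by (auto simp: crossing_def)
  then have "boundary N {x, w} = {#}" by (auto simp: boundary_def filter_mset_eq_conv)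
  then have "{x, w} = verts N"
    using connected_boundary_pos[OF connected, of "{x, w}"] x(1) \<open>w \<in> X\<close> leaf_vert by force
  then have "X \<subseteq> {x, w}" using leaf_vert by blast
  then have "card X \<le> card {x, w}" by (intro card_mono) auto
  also have "\<dots> \<le> 2" by (simp add: card_insert_if)
  finally show False using card_leaves by simp
qed

lemma leaf_verts_delete_suppress:
  assumes "y \<in> X" "x \<in> X" "x \<noteq> y"
  shows "x \<in> verts (delete_suppress N y)"
proof -
  obtain w where w: "pendant N y w" using assms(1) by (rule leaf_pendant)
  then show ?thesis
    using delete_suppress_verts(1)[OF simple w] pendant_not_leaf[OF assms(1) w] assms leaf_vert by auto
qed

lemma deleted_leaf_not_vert:
  assumes "y \<in> X"
  shows "y \<notin> verts (delete_suppress N y)"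
proof -
  obtain w where "pendant N y w" using assms by (rule leaf_pendant)
  then show ?thesis by (rule delete_suppress_verts(2)[OF simple])
qed

lemma pendant_not_in_one_cut:
  assumes S: "one_cut N S" and y: "y \<in> X - S" "pendant N y w" and b: "b \<in> X - S" "b \<noteq> y"
  shows "w \<notin> S"
proof
  assume "w \<in> S"
  then have cr: "crossing S {y, w}" using y(1) by (auto simp: crossing_def)
  obtain e where only: "\<And>d. d \<in># edges N \<Longrightarrow> crossing S d \<Longrightarrow> d = e"
    using S by (rule one_cutE) blast
  have "\<not> crossing (insert y S) d" if d: "d \<in># edges N" for d
  proof (cases "y \<in> d")
    case True
    then have "d = {y, w}" using pendant_edge_iff[OF y(2) d] by simp
    then show ?thesis using \<open>w \<in> S\<close> by (auto simp: crossing_def)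
  next
    case False
    moreover have "d = {y, w}" if "crossing S d"
      using only[OF d that] only[OF pendant_edge[OF y(2)] cr] by simp
    ultimately show ?thesis by (auto simp: crossing_def)
  qed
  then have "boundary N (insert y S) = {#}" by (auto simp: boundary_def filter_mset_eq_conv)
  moreover have "size (boundary N (insert y S)) \<ge> 1"
    using S y b leaf_vert by (intro connected_boundary_pos[OF connected]) (auto simp: one_cut_def)
  ultimately show False by simp
qed

lemma one_cut_delete_leaf:
  assumes S: "one_cut N S" and y: "y \<in> X - S" and b: "b \<in> X - S" "b \<noteq> y"
  shows "one_cut (delete_suppress N y) S"
    and "inner_edges (delete_suppress N y) S = inner_edges N S"
    and "attachments (delete_suppress N y) S = attachments N S"
proof -
  obtain w where w: "pendant N y w" using leaf_pendant[of y] y by auto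
  note * = one_cut_delete_suppress[OF simple w S _ pendant_not_in_one_cut[OF S y w b]]
  show "inner_edges (delete_suppress N y) S = inner_edges N S"
    and att: "attachments (delete_suppress N y) S = attachments N S"
    using * y by auto
  show "one_cut (delete_suppress N y) S"
    using *(1) y S arg_cong[OF att, of size] by (simp add: one_cut_def)
qed

text \<open>
  Deleting a leaf can create further cut-edges inducing the same split; the side of the
  original one is recognisable as the smallest.
\<close>

lemma one_cut_delete_leaf_least:
  assumes S: "one_cut N S" and y: "y \<in> X - S" and b: "b \<in> X - S" "b \<noteq> y"
    and Y: "one_cut (delete_suppress N y) Y" "Y \<inter> X = S \<inter> X"
  shows "S \<subseteq> Y"
proof -
  obtain w where w: "pendant N y w" "w \<in> verts N" using leaf_pendant[of y] y by auto
  have wX: "w \<notin> X" using pendant_not_leaf y w by blast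
  have wS: "w \<notin> S" by (rule pendant_not_in_one_cut[OF S y w(1) b])
  obtain Z where Z: "one_cut N Z" "Y \<subseteq> Z" "Z \<subseteq> Y \<union> {y, w}"
    using one_cut_delete_suppress_lift[OF simple w(1) _ w(2) Y(1)] y leaf_vert by blast
  have tr: "(Z \<inter> S) \<inter> X = S \<inter> X" using Z(2) Y(2) by blast
  have "one_cut N (Z \<inter> S)"
  proof (rule one_cut_Int[OF simple connected Z(1) S])
    show "Z \<inter> S \<noteq> {}" using tr one_cut_trace[OF S] by blast
    have "b \<notin> Z \<union> S" using b Z(3) Y(2) wX by blast
    then show "Z \<union> S \<noteq> verts N" using b leaf_vert by blast
  qed
  then have "Z \<inter> S = S" using S tr by (rule one_cut_unique)
  then show ?thesis using Z(3) wS y by blast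
qed

lemma one_cut_two_leaves:
  assumes S: "one_cut N S" "boundary N S = {#e#}" and e: "\<forall>v\<in>e. v \<notin> leaves N"
  shows "card (S \<inter> X) \<ge> 2"
proof -
  have finX: "finite X" using card_leaves by (metis card.infinite not_numeral_le_zero)
  have "card (S \<inter> X) \<noteq> 0" using one_cut_trace[OF S(1)] finX by simp
  moreover have "card (S \<inter> X) \<noteq> 1"
  proof
    assume "card (S \<inter> X) = 1"
    then obtain a where a: "S \<inter> X = {a}" by (auto simp: card_1_singleton_iff)
    then have aX: "a \<in> X" by blast
    have "boundary N {a} = {#d \<in># edges N. a \<in> d#}"
      unfolding boundary_def
    proof (rule filter_mset_cong)
      fix d assume "d \<in># edges N"
      then show "crossing {a} d = (a \<in> d)"
        using simple_graph_card[OF simple, of d] by (auto simp: crossing_def card_2_iff)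
    qed simp
    then have "one_cut N {a}"
      using leaf_degree[OF aX] leaf_vert[OF aX] by (simp add: one_cut_def simple_graph_degree[OF simple])
    then have "S = {a}" using one_cut_unique[OF S(1)] a by blast
    moreover have "crossing S e"
    proof -
      have "e \<in># boundary N S" using S(2) by simp
      then show ?thesis by (simp add: boundary_def)
    qed
    ultimately have "a \<in> e" by (auto simp: crossing_def)
    then show False using e leaf_degree[OF aX] leaf_vert[OF aX] by (auto simp: leaves_def)
  qed
  ultimately show ?thesis by linarith
qed

lemma decomposable_split:
  assumes "decomposable N"
  obtains S where "one_cut N S" "card (S \<inter> X) \<ge> 2" "card (X - S) \<ge> 2"
proof -
  obtain e where e: "cut_edge N e" "\<forall>v\<in>e. v \<notin> leaves N"
    using assms by (auto simp: decomposable_def trivial_cut_edge_def)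
  obtain S where S: "S \<subseteq> verts N" "boundary N S = {#e#}"
    using simple connected e(1) by (rule cut_edge_one_cut)
  then have cut: "one_cut N S" by (simp add: one_cut_def)
  note co = one_cut_Compl[OF simple cut]
  have "card ((verts N - S) \<inter> X) \<ge> 2"
    by (rule one_cut_two_leaves[OF co(1) _ e(2)]) (simp add: co(2) S(2))
  moreover have "(verts N - S) \<inter> X = X - S" using leaf_vert by blast
  ultimately show thesis using that[OF cut one_cut_two_leaves[OF cut S(2) e(2)]] by simp
qed

end

lemma isomorphism_image_trace:
  assumes f: "bij_betw f V W" "\<forall>x\<in>X - {y}. f x = x" and "X - {y} \<subseteq> V" "y \<notin> W" "y \<notin> R" "R \<subseteq> V"
  shows "f ` R \<inter> X = R \<inter> X"
proof
  show "R \<inter> X \<subseteq> f ` R \<inter> X"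
  proof
    fix x assume "x \<in> R \<inter> X"
    moreover from this have "f x = x" using f(2) assms(5) by auto
    ultimately show "x \<in> f ` R \<inter> X" by force
  qed
  show "f ` R \<inter> X \<subseteq> R \<inter> X"
  proof
    fix x assume x: "x \<in> f ` R \<inter> X"
    then obtain r where r: "r \<in> R" "x = f r" by blast
    then have "x \<in> W" using f(1) assms(6) by (auto simp: bij_betw_def)
    then have "x \<in> X - {y}" using x assms(4) by auto
    then have "f x = f r" "x \<in> V" using f(2) r assms(3) by auto
    then have "x = r" using f(1) r assms(6) by (auto simp: bij_betw_def dest: inj_onD)
    then show "x \<in> R \<inter> X" using r x by blast
  qed
qed

context
  fixes X :: "'a set" and M N :: "'a mgraph" and y :: 'a
  assumes M: "cut_separated_network X M" and N: "cut_separated_network X N"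
    and y: "y \<in> X"
    and eq: "equivalent (X - {y}) (delete_suppress M y) (delete_suppress N y)"
begin

interpretation M: cut_separated_network X M by (rule M)
interpretation N: cut_separated_network X N by (rule N)

lemma one_cut_preimage:
  assumes f: "bij_betw f (verts (delete_suppress M y)) (verts (delete_suppress N y))"
      "edges (delete_suppress N y) = {#f ` e. e \<in># edges (delete_suppress M y)#}"
      "\<forall>x\<in>X - {y}. f x = x"
    and S: "one_cut (delete_suppress N y) S"
  obtains R where "f ` R = S" "one_cut (delete_suppress M y) R" "R \<inter> X = S \<inter> X"
proof -
  define R where "R = {v \<in> verts (delete_suppress M y). f v \<in> S}"
  have SV: "S \<subseteq> verts (delete_suppress N y)" using S by (simp add: one_cut_def)
  then have im: "f ` R = S" using f(1) by (auto simp: R_def bij_betw_def)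
  have RV: "R \<subseteq> verts (delete_suppress M y)" by (auto simp: R_def)
  obtain w where w: "pendant M y w" using y by (rule M.leaf_pendant)
  have "one_cut (delete_suppress M y) R"
    using isomorphism_cut(3)[OF f(1,2) delete_suppress_edges[OF M.simple w] RV] S im by simp
  moreover have "R \<inter> X = S \<inter> X"
  proof -
    have "f ` R \<inter> X = R \<inter> X"
    proof (rule isomorphism_image_trace[OF f(1,3)])
      show "X - {y} \<subseteq> verts (delete_suppress M y)" using M.leaf_verts_delete_suppress[OF y] by auto
      show "y \<notin> R" using M.deleted_leaf_not_vert[OF y] RV by blast
    qed (use N.deleted_leaf_not_vert[OF y] RV in auto)
    then show ?thesis using im by simp
  qed
  ultimately show thesis using that im by blast
qed

lemma side_isomorphism:
  assumes R: "one_cut M R" and S: "one_cut N S" and tr: "R \<inter> X = S \<inter> X"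
    and yS: "y \<notin> S" and b: "b \<in> X - S" "b \<noteq> y"
  obtains f where "bij_betw f R S" "\<And>x. x \<in> X \<inter> R \<Longrightarrow> f x = x"
    "inner_edges N S = {#f ` e. e \<in># inner_edges M R#}"
    "attachments N S = {#f ` e. e \<in># attachments M R#}"
proof -
  obtain f where f: "bij_betw f (verts (delete_suppress M y)) (verts (delete_suppress N y))"
      "edges (delete_suppress N y) = {#f ` e. e \<in># edges (delete_suppress M y)#}"
      "\<forall>x\<in>X - {y}. f x = x"
    using eq by (auto simp: equivalent_def)
  have yN: "y \<in> X - S" and yM: "y \<in> X - R" and bM: "b \<in> X - R" using y yS b tr by blast+
  note MR = M.one_cut_delete_leaf[OF R yM bM b(2)]
  note NS = N.one_cut_delete_leaf[OF S yN b]
  obtain w where w: "pendant M y w" using y by (rule M.leaf_pendant)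
  have RV: "R \<subseteq> verts (delete_suppress M y)" using MR(1) by (simp add: one_cut_def)
  note iso = isomorphism_cut[OF f(1,2) delete_suppress_edges[OF M.simple w] RV]
  have "S \<subseteq> f ` R"
  proof (rule N.one_cut_delete_leaf_least[OF S yN b])
    show "one_cut (delete_suppress N y) (f ` R)" using iso(3) MR(1) by simp
    have "f ` R \<inter> X = R \<inter> X"
    proof (rule isomorphism_image_trace[OF f(1,3)])
      show "X - {y} \<subseteq> verts (delete_suppress M y)" using M.leaf_verts_delete_suppress[OF y] by auto
    qed (use N.deleted_leaf_not_vert[OF y] RV yM in auto)
    then show "f ` R \<inter> X = S \<inter> X" using tr by simp
  qed
  moreover have "f ` R \<subseteq> S"
  proof -
    obtain R' where R': "f ` R' = S" "one_cut (delete_suppress M y) R'" "R' \<inter> X = S \<inter> X"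
      using f NS(1) by (rule one_cut_preimage)
    then have "R \<subseteq> R'" using M.one_cut_delete_leaf_least[OF R yM bM b(2)] tr by simp
    then show ?thesis using R'(1) by blast
  qed
  ultimately have im: "f ` R = S" by blast
  then have "bij_betw f R S" using f(1) RV by (auto simp: bij_betw_def intro: inj_on_subset)
  moreover have "f x = x" if "x \<in> X \<inter> R" for x using that f(3) yM by auto
  ultimately show thesis using that iso(1,2) MR(2,3) NS(2,3) im by simp
qed

lemma one_cut_transfer_up_to_leaf:
  assumes S: "one_cut N S" and yS: "y \<notin> S" and b: "b \<in> X - S" "b \<noteq> y"
  obtains Z where "one_cut M Z" "S \<inter> X \<subseteq> Z" "Z \<inter> X \<subseteq> insert y (S \<inter> X)"
proof -
  obtain f where f: "bij_betw f (verts (delete_suppress M y)) (verts (delete_suppress N y))"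
      "edges (delete_suppress N y) = {#f ` e. e \<in># edges (delete_suppress M y)#}"
      "\<forall>x\<in>X - {y}. f x = x"
    using eq by (auto simp: equivalent_def)
  have yN: "y \<in> X - S" using y yS by blast
  obtain R where R: "one_cut (delete_suppress M y) R" "R \<inter> X = S \<inter> X"
    using f N.one_cut_delete_leaf(1)[OF S yN b] by (rule one_cut_preimage)
  obtain w where w: "pendant M y w" "w \<in> verts M" using y by (rule M.leaf_pendant)
  have "w \<notin> X" by (rule M.pendant_not_leaf[OF y w(1)])
  obtain Z where Z: "one_cut M Z" "R \<subseteq> Z" "Z \<subseteq> R \<union> {y, w}"
    using M.simple w(1) M.leaf_vert[OF y] w(2) R(1) by (rule one_cut_delete_suppress_lift)
  show thesis by (rule that[OF Z(1)]) (use Z(2,3) R(2) \<open>w \<notin> X\<close> in blast)+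
qed

end

lemma one_cut_transfer:
  assumes M: "cut_separated_network X M" and N: "cut_separated_network X N"
    and eq: "\<And>x. x \<in> X \<Longrightarrow> equivalent (X - {x}) (delete_suppress M x) (delete_suppress N x)"
    and S: "one_cut N S" and xyz: "{x, y, z} \<subseteq> X - S" "x \<noteq> y" "z \<noteq> x" "z \<noteq> y"
  obtains R where "one_cut M R" "R \<inter> X = S \<inter> X"
proof -
  interpret M: cut_separated_network X M by (rule M)
  interpret N: cut_separated_network X N by (rule N)
  obtain Y where Y: "one_cut M Y" "S \<inter> X \<subseteq> Y" "Y \<inter> X \<subseteq> insert x (S \<inter> X)"
    using one_cut_transfer_up_to_leaf[OF M N _ eq S, of x y] xyz by auto
  obtain Z where Z: "one_cut M Z" "S \<inter> X \<subseteq> Z" "Z \<inter> X \<subseteq> insert y (S \<inter> X)"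
    using one_cut_transfer_up_to_leaf[OF M N _ eq S, of y x] xyz by auto
  have tr: "(Y \<inter> Z) \<inter> X = S \<inter> X" using Y(2,3) Z(2,3) xyz by blast
  have "one_cut M (Y \<inter> Z)"
  proof (rule one_cut_Int[OF M.simple M.connected Y(1) Z(1)])
    show "Y \<inter> Z \<noteq> {}" using tr N.one_cut_trace[OF S] by blast
    have "z \<in> X" "z \<notin> S" using xyz by auto
    then have "z \<notin> Y \<union> Z" using Y(3) Z(3) xyz by blast
    then show "Y \<union> Z \<noteq> verts M" using M.leaf_vert \<open>z \<in> X\<close> by blast
  qed
  then show thesis using tr by (rule that)
qed

lemma equivalent_of_split:
  assumes M: "cut_separated_network X M" and N: "cut_separated_network X N"
    and eq: "\<And>x. x \<in> X \<Longrightarrow> equivalent (X - {x}) (delete_suppress M x) (delete_suppress N x)"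
    and S: "one_cut N S" and card: "card (S \<inter> X) \<ge> 2" "card (X - S) \<ge> 3"
  shows "equivalent X M N"
proof -
  interpret M: cut_separated_network X M by (rule M)
  interpret N: cut_separated_network X N by (rule N)
  obtain T where T: "T \<subseteq> X - S" "card T = 3" using card(2) by (rule obtain_subset_with_card_n)
  then obtain x y z where xyz: "{x, y, z} \<subseteq> X - S" "x \<noteq> y" "z \<noteq> x" "z \<noteq> y"
    by (auto simp: card_3_iff)
  obtain T' where T': "T' \<subseteq> S \<inter> X" "card T' = 2" using card(1) by (rule obtain_subset_with_card_n)
  then obtain a b where ab: "{a, b} \<subseteq> S \<inter> X" "a \<noteq> b"
    by (auto simp: card_2_iff)
  obtain R where R: "one_cut M R" "R \<inter> X = S \<inter> X"
    using M N eq S xyz by (rule one_cut_transfer)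
  have co: "(verts M - R) \<inter> X = (verts N - S) \<inter> X"
    using R(2) M.leaf_vert N.leaf_vert by blast
  have x: "x \<in> X" "x \<notin> S" and y: "y \<in> X - S" "y \<noteq> x" using xyz by auto
  have a: "a \<in> X" "a \<notin> verts N - S" and b: "b \<in> X - (verts N - S)" "b \<noteq> a" using ab by auto
  obtain f where f: "bij_betw f R S" "\<And>x. x \<in> X \<inter> R \<Longrightarrow> f x = x"
    "inner_edges N S = {#f ` e. e \<in># inner_edges M R#}"
    "attachments N S = {#f ` e. e \<in># attachments M R#}"
    using side_isomorphism[OF M N x(1) eq[OF x(1)] R(1) S R(2) x(2) y] by blast
  obtain g where g: "bij_betw g (verts M - R) (verts N - S)" "\<And>x. x \<in> X \<inter> (verts M - R) \<Longrightarrow> g x = x"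
    "inner_edges N (verts N - S) = {#g ` e. e \<in># inner_edges M (verts M - R)#}"
    "attachments N (verts N - S) = {#g ` e. e \<in># attachments M (verts M - R)#}"
    using side_isomorphism[OF M N a(1) eq[OF a(1)] one_cut_Compl(1)[OF M.simple R(1)]
        one_cut_Compl(1)[OF N.simple S] co a(2) b] by blast
  show ?thesis
  proof (rule equivalent_glue[OF M.simple N.simple R(1) S f g(1) _ g(3,4)])
    show "g x = x" if "x \<in> X - R" for x using g(2) that M.leaf_vert by blast
  qed
qed

theorem theorem4p4:
  fixes X :: "'a set" and N :: "'a mgraph"
  assumes "finite X"
    and "card X \<ge> 5"
    and "phylogenetic_network X N"
    and "decomposable N"
  shows "leaf_reconstructible X N"
  unfolding leaf_reconstructible_def
proof (intro allI impI)
  fix M assume rec: "leaf_reconstruction X N M"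
  have card: "card X \<ge> 3" using assms(2) by simp
  have N: "cut_separated_network X N"
    using assms(3) card by (rule phylogenetic_network_cut_separated)
  then interpret N: cut_separated_network X N .
  have M: "cut_separated_network X M"
    using rec card by (auto simp: leaf_reconstruction_def intro: phylogenetic_network_cut_separated)
  have eq: "equivalent (X - {x}) (delete_suppress M x) (delete_suppress N x)" if "x \<in> X" for x
    using rec that by (simp add: leaf_reconstruction_def)
  obtain S where S: "one_cut N S" "card (S \<inter> X) \<ge> 2" "card (X - S) \<ge> 2"
    using assms(4) by (rule N.decomposable_split)
  have "card X = card (S \<inter> X) + card (X - S)"
    using card_Int_Diff[OF assms(1), of S] by (simp add: Int_commute)
  then consider "card (X - S) \<ge> 3" | "card (S \<inter> X) \<ge> 3" using assms(2) by linarith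
  then show "equivalent X M N"
  proof cases
    case 1
    with M N eq S(1,2) show ?thesis by (rule equivalent_of_split)
  next
    case 2
    have "(verts N - S) \<inter> X = X - S" "X - (verts N - S) = S \<inter> X" using N.leaf_vert by blast+
    then show ?thesis
      using equivalent_of_split[OF M N eq one_cut_Compl(1)[OF N.simple S(1)]] S(3) 2 by simp
  qed
qed

end
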